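(* Let $m\ge 1$ be an integer, let $\delta>0$, and let $\Psi=m!/\xi_m^m$. For all sufficiently large $n$ and all sufficiently small $\varepsilon>0$ (depending on $n$), consider the instance of $n+2$ independent random variables, arriving in the order $X_1,\dots,X_{n+2}$, given by $$X_1=1,\qquad \Pr[X_i=1+\varepsilon(i-1)]=\frac{\xi_m}{n},\ \Pr[X_i=0]=1-\frac{\xi_m}{n}\ \ (2\le i\le n+1),\qquad \Pr\bigl[X_{n+2}=\tfrac{\Psi}{\varepsilon}\bigr]=\varepsilon,\ \Pr[X_{n+2}=0]=1-\varepsilon .$$ Then every single-threshold algorithm $\mathcal{A}$ with $m$ oracle calls satisfies, on this instance, both $$\mathbb{E}[\mathcal{A}]\le (1-e^{-\xi_m}+\delta)\,\mathbb{E}[\max_i X_i]\qquad\text{and}\qquad \Pr\bigl[\mathcal{A}=\max_i X_i\bigr]\le 1-e^{-\xi_m}+\delta ,$$ where $\mathcal{A}$ also denotes the value selected by the algorithm.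
   Context: $\xi_m$ denotes the unique positive solution of $1-e^{-\xi_m}=\frac{\Gamma(m+1,\xi_m)}{m!}$, where $\Gamma(m+1,x)=\int_x^\infty t^m e^{-t}\,dt$; equivalently $\sum_{k=m+1}^\infty \xi_m^k/k!=1$. Oracle model with $m$ calls: realizations are revealed one at a time in the given order, and the algorithm may select at most one value, irrevocably at the time it is observed. At most $m$ times, after observing the current realization $X_i$ and before deciding on it, it may query an oracle, which here answers YES if $X_i\ge \max_{j>i}X_j$ and NO otherwise. The reward is the selected value ($0$ if nothing is selected). Single-threshold algorithm: it has a fixed initial threshold $\tau\geq 0$. Read the sequence; whenever a realization $x$ exceeding the current threshold is encountered, and oracle calls remain, query the oracle at $x$. If the answer is YES, select $x$ and stop; if NO, raise the current threshold to $x$ and continue. If the oracle calls are exhausted, select the first subsequent value that exceeds the current threshold. *)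

theory Defs
  imports "HOL-Probability.Probability"
begin

(* Gamma(m + 1, x) *)
definition upper_Gamma_Suc :: "nat \<Rightarrow> real \<Rightarrow> real" where
  "upper_Gamma_Suc m x = (LBINT t:{x..}. t ^ m * exp (- t))"

definition xi :: "nat \<Rightarrow> real" where
  "xi m = (THE x. x > 0 \<and> 1 - exp (- x) = upper_Gamma_Suc m x / fact m)"

definition Psi :: "nat \<Rightarrow> real" where
  "Psi m = fact m / xi m ^ m"

(* The answer to a query at x when the values ys are still to come; at the last value
   (ys empty) the answer is YES. *)
definition oracle_yes :: "real \<Rightarrow> real list \<Rightarrow> bool" where
  "oracle_yes x ys \<longleftrightarrow> (\<forall>y\<in>set ys. y \<le> x)"

(* The value selected with k oracle calls left and current threshold \<tau> on the remaining
   sequence. The list ys enters the decision on x only through the oracle's answer. *)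
fun single_threshold :: "nat \<Rightarrow> real \<Rightarrow> real list \<Rightarrow> real" where
  "single_threshold k \<tau> [] = 0"
| "single_threshold 0 \<tau> (x # ys) = (if x > \<tau> then x else single_threshold 0 \<tau> ys)"
| "single_threshold (Suc k) \<tau> (x # ys) =
     (if x > \<tau> then if oracle_yes x ys then x else single_threshold k x ys
      else single_threshold (Suc k) \<tau> ys)"

(* bernoulli_pmf clamps its parameter to [0, 1]; this has no effect once n \<ge> xi m and
   0 \<le> \<epsilon> \<le> 1. *)
definition value_pmf :: "nat \<Rightarrow> nat \<Rightarrow> real \<Rightarrow> nat \<Rightarrow> real pmf" where
  "value_pmf m n \<epsilon> i =
     (if i = 1 then return_pmf 1
      else if i \<le> n + 1 then
        map_pmf (\<lambda>b. if b then 1 + \<epsilon> * (real i - 1) else 0) (bernoulli_pmf (xi m / real n))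
      else map_pmf (\<lambda>b. if b then Psi m / \<epsilon> else 0) (bernoulli_pmf \<epsilon>))"

(* The joint law of the independent values; an outcome X has X i as its i-th value. *)
definition instance_pmf :: "nat \<Rightarrow> nat \<Rightarrow> real \<Rightarrow> (nat \<Rightarrow> real) pmf" where
  "instance_pmf m n \<epsilon> = Pi_pmf {1..n + 2} 0 (value_pmf m n \<epsilon>)"

lemma indep_vars_instance_pmf:
  "prob_space.indep_vars (measure_pmf (instance_pmf m n \<epsilon>)) (\<lambda>_. borel) (\<lambda>i X. X i) {1..n + 2}"
  unfolding instance_pmf_def
  by (rule prob_space.indep_vars_compose2[OF prob_space_measure_pmf indep_vars_Pi_pmf]) auto

lemma map_pmf_instance_pmf:
  "i \<in> {1..n + 2} \<Longrightarrow> map_pmf (\<lambda>X. X i) (instance_pmf m n \<epsilon>) = value_pmf m n \<epsilon> i"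
  unfolding instance_pmf_def by (subst Pi_pmf_component) auto

definition max_value :: "nat \<Rightarrow> (nat \<Rightarrow> real) \<Rightarrow> real" where
  "max_value n X = Max (X ` {1..n + 2})"

definition alg_value :: "nat \<Rightarrow> nat \<Rightarrow> real \<Rightarrow> (nat \<Rightarrow> real) \<Rightarrow> real" where
  "alg_value m n \<tau> X = single_threshold m \<tau> (map X [1..<n + 3])"

end

theory Submission imports Defs "HOL-Real_Asymp.Real_Asymp" begin

text \<open>
  Let \<open>c\<close> be the number of the values \<open>X\<^sub>1, \<dots>, X\<^sub>n\<^sub>+\<^sub>1\<close> that exceed \<open>\<tau>\<close>. These values increase, so as long as
  calls remain and a larger value is still to come the oracle answers NO: if \<open>X\<^sub>n\<^sub>+\<^sub>2 \<noteq> 0\<close>, the last value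
  can be reached only if \<open>c \<le> m\<close>; if \<open>X\<^sub>n\<^sub>+\<^sub>2 = 0\<close>, a nonzero value requires \<open>c \<ge> 1\<close> and the maximum
  requires \<open>1 \<le> c \<le> m + 1\<close>. As \<open>\<epsilon> \<rightarrow> 0\<close> the reward is thus at most \<open>\<Psi> P(c \<le> m) + P(c \<ge> 1)\<close>, against an expected
  maximum of \<open>\<Psi> + 1\<close>. If \<open>\<tau> \<ge> 1\<close> then \<open>c\<close> is binomial with parameters \<open>N \<le> n\<close> and \<open>\<xi>/n\<close>; by the choice of
  \<open>\<Psi>\<close> the reward is, up to \<open>O(1/n)\<close>, largest for \<open>N = n\<close>. If \<open>\<tau> < 1\<close> then \<open>c - 1\<close> is binomial with
  parameters \<open>n\<close> and \<open>\<xi>/n\<close>. The Poisson limit and the equation defining \<open>\<xi>\<close> give \<open>(1 - e\<^sup>-\<^sup>\<xi>)(\<Psi> + 1)\<close> in both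
  cases.
\<close>

section \<open>The constant \<open>\<xi>\<close>\<close>

text \<open>The derivative of each Poisson mass is the preceding mass minus the mass itself, so the
  sum telescopes.\<close>

lemma has_field_derivative_poisson_cdf:
  "((\<lambda>x::real. \<Sum>k\<le>m. x ^ k / fact k * exp (- x)) has_field_derivative
     - (x ^ m / fact m * exp (- x))) (at x)"
proof (induction m)
  case 0
  show ?case by (auto intro!: derivative_eq_intros)
next
  case (Suc m)
  have "((\<lambda>x::real. x ^ Suc m / fact (Suc m) * exp (- x)) has_field_derivative
      (x ^ m / fact m * exp (- x) - x ^ Suc m / fact (Suc m) * exp (- x))) (at x)"
    by (rule derivative_eq_intros refl | simp)+
  from DERIV_add[OF Suc this] show ?case by simp
qed

lemma tendsto_poisson_cdf_at_top:
  "((\<lambda>x::real. \<Sum>k\<le>m. x ^ k / fact k * exp (- x)) \<longlongrightarrow> 0) at_top"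
proof (rule tendsto_null_sum)
  fix k
  have "((\<lambda>x::real. x ^ k / exp x / fact k) \<longlongrightarrow> 0 / fact k) at_top"
    by (intro tendsto_divide tendsto_power_div_exp_0 tendsto_const) auto
  then show "((\<lambda>x::real. x ^ k / fact k * exp (- x)) \<longlongrightarrow> 0) at_top"
    by (simp add: exp_minus field_simps)
qed

text \<open>\<open>- fact m\<close> times the Poisson distribution function is an antiderivative of
  \<open>t ^ m * exp (- t)\<close> that vanishes at infinity.\<close>

lemma upper_Gamma_Suc_eq:
  assumes "x \<ge> 0"
  shows "upper_Gamma_Suc m x / fact m = (\<Sum>k\<le>m. x ^ k / fact k * exp (- x))"
proof -
  let ?P = "\<lambda>x::real. \<Sum>k\<le>m. x ^ k / fact k * exp (- x)"
  have "(\<integral>\<^sup>+t. ennreal (t ^ m * exp (- t)) * indicator {x ..} t \<partial>lborel)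
      = ennreal (- fact m * 0 - (- fact m * ?P x))"
  proof (rule nn_integral_FTC_atLeast[where F = "\<lambda>t. - fact m * ?P t"])
    fix t assume "x \<le> t"
    show "((\<lambda>t. - fact m * ?P t) has_real_derivative t ^ m * exp (- t)) (at t)"
      by (rule derivative_eq_intros has_field_derivative_poisson_cdf refl)+ simp
    show "0 \<le> t ^ m * exp (- t)" using assms \<open>x \<le> t\<close> by simp
  next
    show "((\<lambda>t. - fact m * ?P t) \<longlongrightarrow> - fact m * 0) at_top"
      by (intro tendsto_mult tendsto_const tendsto_poisson_cdf_at_top)
  qed simp
  then have "(\<integral>\<^sup>+t. ennreal (indicator {x ..} t *\<^sub>R (t ^ m * exp (- t))) \<partial>lborel)
      = ennreal (fact m * ?P x)"
    by (simp add: indicator_mult_ennreal mult.commute)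
  moreover have "fact m * ?P x \<ge> 0"
    using assms by (intro mult_nonneg_nonneg sum_nonneg) auto
  ultimately have "upper_Gamma_Suc m x = fact m * ?P x"
    unfolding upper_Gamma_Suc_def set_lebesgue_integral_def
    using assms by (subst integral_eq_nn_integral) (auto simp: indicator_def)
  then show ?thesis by simp
qed

text \<open>The difference \<open>h\<close> of the two sides of the defining equation increases
  strictly on the nonnegative reals, from -1 at 0 to the limit 1. Its unique zero justifies the
  \<open>THE\<close> in \<open>xi\<close>.\<close>

lemma xi:
  assumes "m \<ge> 1"
  shows xi_pos: "xi m > 0"
    and poisson_cdf_xi: "(\<Sum>k\<le>m. xi m ^ k / fact k * exp (- xi m)) = 1 - exp (- xi m)"
proof -
  define h :: "real \<Rightarrow> real"
    where "h x = 1 - exp (- x) - (\<Sum>k\<le>m. x ^ k / fact k * exp (- x))" for x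
  have deriv: "(h has_real_derivative exp (- x) + x ^ m / fact m * exp (- x)) (at x)" for x
    unfolding h_def by (rule derivative_eq_intros has_field_derivative_poisson_cdf refl | simp)+
  have strict: "h x < h y" if "0 \<le> x" "x < y" for x y
  proof (rule DERIV_pos_imp_increasing[OF \<open>x < y\<close>])
    fix t assume "x \<le> t"
    then have "exp (- t) + t ^ m / fact m * exp (- t) > 0"
      using that by (intro add_pos_nonneg mult_nonneg_nonneg) auto
    then show "\<exists>d. (h has_real_derivative d) (at t) \<and> d > 0" using deriv by blast
  qed
  have h0: "h 0 = - 1" using assms by (simp add: h_def sum.atMost_shift)
  have "(h \<longlongrightarrow> 1 - 0 - 0) at_top"
    unfolding h_def
    by (intro tendsto_diff tendsto_const tendsto_poisson_cdf_at_top)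
       (simp add: filterlim_compose[OF exp_at_bot filterlim_uminus_at_bot_at_top])
  then have "\<forall>\<^sub>F x in at_top. h x > 0" by (rule order_tendstoD) simp
  then have "\<forall>\<^sub>F x in at_top. h x > 0 \<and> x > (0::real)"
    using eventually_gt_at_top[of 0] by (rule eventually_conj)
  then obtain b where b: "h b > 0" "b > 0" by (auto dest: eventually_happens)
  have "\<exists>x\<ge>0. x \<le> b \<and> h x = 0"
    using b h0 by (intro IVT') (auto intro!: continuous_at_imp_continuous_on DERIV_isCont[OF deriv])
  then obtain x where x: "x \<ge> 0" "h x = 0" by blast
  have "x > 0" using x h0 by (cases "x = 0") auto
  have eq: "1 - exp (- y) = upper_Gamma_Suc m y / fact m \<longleftrightarrow> h y = 0" if "y > 0" for y
    using that by (auto simp: upper_Gamma_Suc_eq h_def)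
  have "\<exists>!x. x > 0 \<and> 1 - exp (- x) = upper_Gamma_Suc m x / fact m"
  proof (rule ex1I)
    show "x > 0 \<and> 1 - exp (- x) = upper_Gamma_Suc m x / fact m"
      using x eq \<open>x > 0\<close> by simp
    fix y assume y: "y > 0 \<and> 1 - exp (- y) = upper_Gamma_Suc m y / fact m"
    then have "h y = 0" using eq by blast
    then show "y = x" using x y strict[of x y] strict[of y x] by (cases x y rule: linorder_cases) auto
  qed
  from theI'[OF this] have *: "xi m > 0" "1 - exp (- xi m) = upper_Gamma_Suc m (xi m) / fact m"
    unfolding xi_def by auto
  show "xi m > 0" by fact
  show "(\<Sum>k\<le>m. xi m ^ k / fact k * exp (- xi m)) = 1 - exp (- xi m)"
    using * by (simp add: upper_Gamma_Suc_eq)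
qed

section \<open>The algorithm on an increasing sequence\<close>

text \<open>A value of at most \<open>\<sigma>\<close> is never queried or selected, and it cannot
  change the oracle's answer at a value above \<open>\<tau>\<close>.\<close>

lemma single_threshold_filter:
  assumes "\<sigma> \<le> \<tau>"
  shows "single_threshold k \<tau> (filter (\<lambda>z. z > \<sigma>) zs) = single_threshold k \<tau> zs"
  using assms
proof (induction k \<tau> zs rule: single_threshold.induct)
  case (3 k \<tau> x ys)
  have "oracle_yes x (filter (\<lambda>z. z > \<sigma>) ys) = oracle_yes x ys" if "x > \<tau>"
    using that "3.prems" by (force simp: oracle_yes_def)
  with 3 show ?case by auto
qed auto

text \<open>Every value but the last is followed by a larger one, so a query there is answered NO.
  The calls are used up on the first \<open>k\<close> values and the next one is taken, unless the
  list ends earlier and its last value gets YES.\<close>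

lemma single_threshold_increasing:
  assumes "sorted_wrt (<) zs" "\<forall>z\<in>set zs. z > \<tau>" "zs \<noteq> []"
  shows "single_threshold k \<tau> zs = zs ! min k (length zs - 1)"
  using assms
proof (induction k \<tau> zs rule: single_threshold.induct)
  case (3 k \<tau> x ys)
  show ?case
  proof (cases "ys = []")
    case False
    then have "\<not> oracle_yes x ys"
      using "3.prems" by (cases ys) (auto simp: oracle_yes_def)
    moreover from this have "single_threshold k x ys = ys ! min k (length ys - 1)"
      using 3 False by auto
    moreover have "min (Suc k) (length ys) = Suc (min k (length ys - 1))"
      using False by (cases ys) auto
    ultimately show ?thesis using "3.prems" by simp
  qed (use 3 in \<open>auto simp: oracle_yes_def\<close>)
qed auto

section \<open>Binomial probabilities\<close>

text \<open>An extra trial lifts the count above \<open>m\<close> exactly when the count was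
  \<open>m\<close> and the trial succeeds.\<close>

lemma binomial_mass_Suc:
  fixes p :: real
  shows "(\<Sum>k\<le>m. (Suc n choose k) * p ^ k * (1 - p) ^ (Suc n - k))
    = (\<Sum>k\<le>m. (n choose k) * p ^ k * (1 - p) ^ (n - k)) - p * ((n choose m) * p ^ m * (1 - p) ^ (n - m))"
proof (induction m)
  case (Suc m)
  have "n - m = Suc (n - Suc m)" if "m < n" using that by simp
  then have "real (Suc n choose Suc m) * p ^ Suc m * (1 - p) ^ (Suc n - Suc m)
     = p * ((n choose m) * p ^ m * (1 - p) ^ (n - m))
       + (1 - p) * ((n choose Suc m) * p ^ Suc m * (1 - p) ^ (n - Suc m))"
    by (cases n m rule: linorder_cases) (auto simp: algebra_simps)
  with Suc show ?case by (simp add: algebra_simps)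
qed (simp add: algebra_simps)

text \<open>Induction on \<open>k\<close>: the ratio \<open>?r\<close> of consecutive masses tends
  to \<open>x / Suc k\<close>.\<close>

lemma tendsto_binomial_poisson:
  fixes x :: real
  shows "(\<lambda>n. (n choose k) * (x / n) ^ k * (1 - x / n) ^ (n - k)) \<longlonglongrightarrow> x ^ k / fact k * exp (- x)"
proof (induction k)
  case 0
  show ?case using tendsto_exp_limit_sequentially[of "- x"] by simp
next
  case (Suc k)
  let ?q = "\<lambda>k n. real (n choose k) * (x / real n) ^ k * (1 - x / real n) ^ (n - k)"
  let ?r = "\<lambda>n. (real n - real k) * (x / real n) / (1 - x / real n) / real (Suc k)"
  have "(\<lambda>n. (real n - real k) * (x / real n) / (1 - x / real n)) \<longlonglongrightarrow> x"
    by real_asymp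
  then have "(\<lambda>n. ?q k n * ?r n) \<longlonglongrightarrow> x ^ k / fact k * exp (- x) * (x / real (Suc k))"
    by (intro tendsto_mult Suc tendsto_divide tendsto_const) auto
  \<comment> \<open>\<open>n > k\<close> avoids truncated subtraction; \<open>n > x\<close> makes
    the divisor \<open>1 - x / n\<close> nonzero.\<close>
  moreover have "\<forall>\<^sub>F n in sequentially. ?q k n * ?r n = ?q (Suc k) n"
    using eventually_gt_at_top[of k] eventually_gt_at_top[of "nat \<lceil>x\<rceil>"]
  proof eventually_elim
    case (elim n)
    have choose: "real (n choose Suc k) = real (n choose k) * (real n - real k) / real (Suc k)"
      using binomial_absorb_comp[of n k] binomial_absorption[of k n] elim(1)
      by (simp add: field_simps flip: of_nat_mult of_nat_diff of_nat_Suc)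
    have nonzero: "1 - x / real n \<noteq> 0" using elim by (auto simp: field_simps)
    \<comment> \<open>The algebra in abstract variables: \<open>a\<close> stands for
      \<open>1 - x / n\<close>, \<open>b\<close> for \<open>x / n\<close>, \<open>A\<close> and
      \<open>B\<close> for powers of them.\<close>
    have cancel: "c * B * (a * A) * (d * b / a / s) = c * d / s * (b * B) * A"
      if "a \<noteq> 0" for a b c d s A B :: real
      using that by simp
    have power: "(1 - x / real n) ^ (n - k) = (1 - x / real n) * (1 - x / real n) ^ (n - Suc k)"
      by (simp only: power_Suc flip: Suc_diff_Suc[OF elim(1)])
    show ?case unfolding power choose power_Suc[of "x / real n"] by (rule cancel[OF nonzero])
  qed
  ultimately have "?q (Suc k) \<longlonglongrightarrow> x ^ k / fact k * exp (- x) * (x / real (Suc k))"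
    by (rule Lim_transform_eventually)
  then show ?case by (simp add: field_simps)
qed

section \<open>The instance\<close>

text \<open>Leaving out the last value allows conditioning on it: a function update puts either of
  its outcomes back.\<close>

definition initial_pmf :: "nat \<Rightarrow> nat \<Rightarrow> real \<Rightarrow> (nat \<Rightarrow> real) pmf" where
  "initial_pmf m n \<epsilon> = Pi_pmf {1..n + 1} 0 (value_pmf m n \<epsilon>)"

definition exceedances :: "nat \<Rightarrow> real \<Rightarrow> (nat \<Rightarrow> real) \<Rightarrow> nat" where
  "exceedances n \<tau> X = card {i \<in> {1..n + 1}. X i > \<tau>}"

lemma finite_set_initial_pmf: "finite (set_pmf (initial_pmf m n \<epsilon>))"
  unfolding initial_pmf_def
  by (subst set_Pi_pmf) (auto simp: value_pmf_def intro!: finite_PiE_dflt)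

lemma set_initial_pmfD:
  assumes "X \<in> set_pmf (initial_pmf m n \<epsilon>)"
  shows "X 1 = 1" and "i \<in> {1..n + 1} \<Longrightarrow> X i = 0 \<or> X i = 1 + \<epsilon> * (real i - 1)"
proof -
  have "X i \<in> set_pmf (value_pmf m n \<epsilon> i)" if "i \<in> {1..n + 1}" for i
    using assms that by (auto simp: initial_pmf_def set_Pi_pmf PiE_dflt_def)
  from this[of 1] this[of i] show "X 1 = 1" "i \<in> {1..n + 1} \<Longrightarrow> X i = 0 \<or> X i = 1 + \<epsilon> * (real i - 1)"
    by (auto simp: value_pmf_def split: if_splits)
qed

lemma instance_pmf_conv_initial_pmf:
  "instance_pmf m n \<epsilon> = bernoulli_pmf \<epsilon> \<bind>
     (\<lambda>b. map_pmf (\<lambda>X. X(n + 2 := if b then Psi m / \<epsilon> else 0)) (initial_pmf m n \<epsilon>))"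
proof -
  have "{1..n + 2} = insert (n + 2) {1..n + 1}" by auto
  then show ?thesis
    by (simp add: instance_pmf_def initial_pmf_def Pi_pmf_insert' value_pmf_def map_pmf_def
        bind_assoc_pmf bind_return_pmf)
qed

text \<open>Conditioning on the independent last value; finite support settles
  integrability.\<close>

lemma expectation_instance_pmf:
  fixes h :: "(nat \<Rightarrow> real) \<Rightarrow> real"
  assumes "0 \<le> \<epsilon>" "\<epsilon> \<le> 1"
  shows "measure_pmf.expectation (instance_pmf m n \<epsilon>) h =
    \<epsilon> * measure_pmf.expectation (initial_pmf m n \<epsilon>) (\<lambda>X. h (X(n + 2 := Psi m / \<epsilon>)))
    + (1 - \<epsilon>) * measure_pmf.expectation (initial_pmf m n \<epsilon>) (\<lambda>X. h (X(n + 2 := 0)))"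
  unfolding instance_pmf_conv_initial_pmf
  using assms by (subst pmf_expectation_bind[of UNIV]) (auto simp: UNIV_bool finite_set_initial_pmf)

text \<open>The events \<open>X i \<noteq> 0\<close> for \<open>i\<close> in \<open>J\<close> are
  independent with probability \<open>xi m / n\<close>, since \<open>\<epsilon> \<ge> 0\<close>
  keeps \<open>1 + \<epsilon> * (real i - 1)\<close> away from 0.\<close>

lemma map_pmf_card_nonzero_initial_pmf:
  assumes "J \<subseteq> {2..n + 1}" "0 \<le> \<epsilon>" "0 \<le> xi m / n" "xi m / n \<le> 1"
  shows "map_pmf (\<lambda>X. card {i \<in> J. X i \<noteq> 0}) (initial_pmf m n \<epsilon>) = binomial_pmf (card J) (xi m / n)"
proof -
  have "finite J" using assms(1) finite_subset by blast
  have val: "map_pmf (\<lambda>x. x \<noteq> 0) (value_pmf m n \<epsilon> i) = bernoulli_pmf (xi m / n)" if "i \<in> J" for i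
  proof -
    have i: "i \<noteq> 1" "i \<le> n + 1" using assms(1) that by auto
    have "\<epsilon> * (real i - 1) \<ge> 0"
      using assms(1,2) that by (intro mult_nonneg_nonneg) auto
    then have "(\<lambda>b. (if b then 1 + \<epsilon> * (real i - 1) else 0) \<noteq> 0) = (\<lambda>b. b)"
      by auto
    with i show ?thesis by (simp add: value_pmf_def pmf.map_comp o_def)
  qed
  have "binomial_pmf (card J) (xi m / n)
      = map_pmf (\<lambda>B. card {i \<in> J. B i}) (Pi_pmf J False (\<lambda>i. map_pmf (\<lambda>x. x \<noteq> 0) (value_pmf m n \<epsilon> i)))"
    using assms \<open>finite J\<close> val
    by (subst binomial_pmf_altdef'[of J _ _ False]) (auto intro!: map_pmf_cong Pi_pmf_cong)
  also have "\<dots> = map_pmf (\<lambda>X. card {i \<in> J. X i \<noteq> 0}) (Pi_pmf J 0 (value_pmf m n \<epsilon>))"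
    using \<open>finite J\<close> by (subst Pi_pmf_map[where dflt = 0]) (auto simp: pmf.map_comp o_def)
  also have "Pi_pmf J 0 (value_pmf m n \<epsilon>)
      = map_pmf (\<lambda>X i. if i \<in> J then X i else 0) (initial_pmf m n \<epsilon>)"
    unfolding initial_pmf_def using assms(1) by (intro Pi_pmf_subset) auto
  also have "map_pmf (\<lambda>X. card {i \<in> J. X i \<noteq> 0}) \<dots>
      = map_pmf (\<lambda>X. card {i \<in> J. X i \<noteq> 0}) (initial_pmf m n \<epsilon>)"
    by (auto simp: pmf.map_comp o_def intro!: map_pmf_cong arg_cong[where f = card])
  finally show ?thesis by simp
qed

text \<open>Reduces the count to nonzero values over a fixed index set, where its law is binomial.
  The constant first value exceeds \<open>\<tau>\<close> only if \<open>\<tau> < 1\<close>, hence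
  the \<open>Suc\<close>.\<close>

lemma exceedances_eq:
  assumes "X \<in> set_pmf (initial_pmf m n \<epsilon>)" "0 \<le> \<epsilon>" "0 \<le> \<tau>"
  shows "\<tau> \<ge> 1 \<Longrightarrow> exceedances n \<tau> X = card {i \<in> {i \<in> {2..n + 1}. 1 + \<epsilon> * (real i - 1) > \<tau>}. X i \<noteq> 0}"
    and "\<tau> < 1 \<Longrightarrow> exceedances n \<tau> X = Suc (card {i \<in> {2..n + 1}. X i \<noteq> 0})"
proof -
  note X = set_initial_pmfD[OF assms(1)]
  have split: "{1..n + 1} = insert 1 {2..n + 1}" by auto
  show "exceedances n \<tau> X = card {i \<in> {i \<in> {2..n + 1}. 1 + \<epsilon> * (real i - 1) > \<tau>}. X i \<noteq> 0}"
    if "\<tau> \<ge> 1"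
  proof -
    have *: "X i > \<tau> \<longleftrightarrow> 1 + \<epsilon> * (real i - 1) > \<tau> \<and> X i \<noteq> 0" if "i \<in> {2..n + 1}" for i
      using X(2)[of i] that \<open>\<tau> \<ge> 1\<close> by auto
    have "{i \<in> {1..n + 1}. X i > \<tau>} = {i \<in> {i \<in> {2..n + 1}. 1 + \<epsilon> * (real i - 1) > \<tau>}. X i \<noteq> 0}"
      unfolding split using that X(1) * by auto
    then show ?thesis by (simp add: exceedances_def)
  qed
  show "exceedances n \<tau> X = Suc (card {i \<in> {2..n + 1}. X i \<noteq> 0})" if "\<tau> < 1"
  proof -
    have "X i > \<tau> \<longleftrightarrow> X i \<noteq> 0" if i: "i \<in> {2..n + 1}" for i
    proof -
      have "\<epsilon> * (real i - 1) \<ge> 0" using i assms(2) by (intro mult_nonneg_nonneg) auto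
      then show ?thesis using X(2)[of i] i \<open>\<tau> < 1\<close> assms(3) by auto
    qed
    then have "{i \<in> {1..n + 1}. X i > \<tau>} = insert 1 {i \<in> {2..n + 1}. X i \<noteq> 0}"
      unfolding split using that X(1) by auto
    then show ?thesis by (simp add: exceedances_def)
  qed
qed

text \<open>The values above \<open>\<tau>\<close> form an increasing list \<open>zs\<close>,
  because zero never exceeds \<open>\<tau>\<close> and the nonzero values grow with the index. This
  locates the selected value by \<open>single_threshold_increasing\<close>.\<close>

lemma
  assumes X: "X \<in> set_pmf (initial_pmf m n \<epsilon>)" and \<epsilon>: "0 < \<epsilon>" and \<tau>: "0 \<le> \<tau>"
  shows alg_value_last_zero_le:
      "alg_value k n \<tau> (X(n + 2 := 0)) \<le> (1 + n * \<epsilon>) * of_bool (exceedances n \<tau> X \<ge> 1)"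
    and alg_value_last_large_le:
      "y > 1 + n * \<epsilon> \<Longrightarrow> alg_value k n \<tau> (X(n + 2 := y)) \<le> y * of_bool (exceedances n \<tau> X \<le> k) + (1 + n * \<epsilon>)"
    and alg_value_eq_max_imp:
      "alg_value k n \<tau> (X(n + 2 := 0)) = max_value n (X(n + 2 := 0)) \<Longrightarrow>
        exceedances n \<tau> X \<in> {1..Suc k}"
proof -
  define zs where "zs = filter (\<lambda>z. z > \<tau>) (map X [1..<n + 2])"
  note val = set_initial_pmfD[OF X]
  have val_le: "X i \<le> 1 + n * \<epsilon>" if "i \<in> {1..n + 1}" for i
    using val(2)[OF that] that \<epsilon> mult_left_mono[of "real i - 1" "real n" \<epsilon>]
    by (auto simp: mult.commute)
  have zs_le: "z \<le> 1 + n * \<epsilon>" if "z \<in> set zs" for z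
    using that val_le by (auto simp: zs_def simp del: upt_Suc)
  have zs_gt: "\<forall>z\<in>set zs. z > \<tau>" by (simp add: zs_def)
  have mono: "X i < X j" if "i \<in> {1..n + 1}" "j \<in> {1..n + 1}" "i < j" "X i > \<tau>" "X j > \<tau>" for i j
    using val(2)[OF that(1)] val(2)[OF that(2)] that \<epsilon> \<tau> by auto
  have sorted: "sorted_wrt (<) zs"
    unfolding zs_def filter_map sorted_wrt_map
    by (rule sorted_wrt_mono_rel[OF _ sorted_wrt_filter[OF sorted_wrt_upt]])
       (auto intro!: mono simp del: upt_Suc)
  have len: "length zs = exceedances n \<tau> X"
  proof -
    have "length zs = card (set (filter (\<lambda>i. X i > \<tau>) [1..<n + 2]))"
      by (subst distinct_card) (auto simp: zs_def filter_map o_def)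
    also have "set (filter (\<lambda>i. X i > \<tau>) [1..<n + 2]) = {i \<in> {1..n + 1}. X i > \<tau>}"
      by (auto simp del: upt_Suc)
    finally show ?thesis by (simp add: exceedances_def)
  qed
  have alg: "alg_value k n \<tau> (X(n + 2 := y)) = single_threshold k \<tau> (zs @ filter (\<lambda>z. z > \<tau>) [y])" for y
  proof -
    have "[1..<n + 3] = [1..<n + 2] @ [n + 2]" by (simp add: numeral_eq_Suc)
    moreover have "map (X(n + 2 := y)) [1..<n + 2] = map X [1..<n + 2]" by auto
    ultimately have "map (X(n + 2 := y)) [1..<n + 3] = map X [1..<n + 2] @ [y]" by simp
    then show ?thesis
      unfolding alg_value_def zs_def
      by (metis filter_append order_refl single_threshold_filter)
  qed
  have alg0: "alg_value k n \<tau> (X(n + 2 := 0)) = (if zs = [] then 0 else zs ! min k (length zs - 1))"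
    using alg[of 0] \<tau> single_threshold_increasing[OF sorted zs_gt] by auto
  have nth_in: "zs ! min k (length zs - 1) \<in> set zs" if "zs \<noteq> []"
    using that by (intro nth_mem) (cases zs, auto)
  show "alg_value k n \<tau> (X(n + 2 := 0)) \<le> (1 + n * \<epsilon>) * of_bool (exceedances n \<tau> X \<ge> 1)"
    using alg0 zs_le nth_in by (cases "zs = []") (auto simp flip: len simp: Suc_le_eq)
  have bound_pos: "0 \<le> 1 + n * \<epsilon>" using \<epsilon> by simp
  show "alg_value k n \<tau> (X(n + 2 := y)) \<le> y * of_bool (exceedances n \<tau> X \<le> k) + (1 + n * \<epsilon>)"
    if y: "y > 1 + n * \<epsilon>"
  proof (cases "y > \<tau>")
    \<comment> \<open>A last value of at most \<open>\<tau>\<close> is filtered out just as 0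
      is.\<close>
    case False
    then have "alg_value k n \<tau> (X(n + 2 := y)) = alg_value k n \<tau> (X(n + 2 := 0))"
      unfolding alg using \<tau> by simp
    also have "\<dots> \<le> 1 + n * \<epsilon>"
      using alg0 zs_le nth_in bound_pos by (cases "zs = []") auto
    finally show ?thesis using y bound_pos by (auto simp: of_bool_def)
  next
    case True
    have "sorted_wrt (<) (zs @ [y])"
      using sorted zs_le y by (fastforce simp: sorted_wrt_append)
    then have "alg_value k n \<tau> (X(n + 2 := y)) = (zs @ [y]) ! min k (length zs)"
      unfolding alg using True zs_gt by (simp add: single_threshold_increasing)
    \<comment> \<open>\<open>y\<close> sits at index \<open>length zs\<close>, so it is selected
      only if \<open>length zs \<le> k\<close>.\<close>
    moreover have "\<dots> \<le> y * of_bool (length zs \<le> k) + (1 + n * \<epsilon>)"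
    proof (cases "length zs \<le> k")
      case False
      then have "(zs @ [y]) ! min k (length zs) \<in> set zs" by (simp add: nth_append)
      with False show ?thesis using zs_le by simp
    qed (use bound_pos in simp)
    ultimately show ?thesis by (simp add: len)
  qed
  show "exceedances n \<tau> X \<in> {1..Suc k}"
    if win: "alg_value k n \<tau> (X(n + 2 := 0)) = max_value n (X(n + 2 := 0))"
  proof -
    have le_max: "X i \<le> max_value n (X(n + 2 := 0))" if "i \<in> {1..n + 1}" for i
      unfolding max_value_def using that by (intro Max_ge) (auto intro!: image_eqI[of _ _ i])
    have "max_value n (X(n + 2 := 0)) \<ge> 1" using le_max[of 1] val(1) by simp
    then have "zs \<noteq> []" using alg0 win by auto
    have "last zs \<in> set zs" using \<open>zs \<noteq> []\<close> by simp
    then have "last zs \<le> max_value n (X(n + 2 := 0))" using le_max by (auto simp: zs_def simp del: upt_Suc)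
    \<comment> \<open>With more exceedances the selected value is \<open>zs ! k\<close>, strictly
      below the last one.\<close>
    have "length zs \<le> Suc k"
    proof (rule ccontr)
      assume "\<not> length zs \<le> Suc k"
      then have "zs ! k < last zs"
        using sorted_wrt_nth_less[OF sorted, of k "length zs - 1"] \<open>zs \<noteq> []\<close>
        by (simp add: last_conv_nth)
      moreover have "min k (length zs - 1) = k" using \<open>\<not> length zs \<le> Suc k\<close> by simp
      ultimately show False using alg0 win \<open>last zs \<le> _\<close> \<open>zs \<noteq> []\<close> by simp
    qed
    moreover have "length zs \<ge> 1" using \<open>zs \<noteq> []\<close> by (cases zs) auto
    ultimately show ?thesis by (simp add: len)
  qed
qed

section \<open>Bounds on the reward, the winning probability and the expected maximum\<close>

lemma expectation_of_bool:
  fixes M :: "'a pmf"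
  shows "measure_pmf.expectation M (\<lambda>x. of_bool (P x)) = measure_pmf.prob M {x. P x}"
proof -
  have "(\<lambda>x. of_bool (P x)) = indicat_real {x. P x}" by (auto simp: indicator_def)
  then show ?thesis by simp
qed

lemma expectation_mono_pmf:
  fixes f g :: "'a \<Rightarrow> real"
  assumes "finite (set_pmf M)" "\<And>x. x \<in> set_pmf M \<Longrightarrow> f x \<le> g x"
  shows "measure_pmf.expectation M f \<le> measure_pmf.expectation M g"
  using assms by (intro integral_mono_AE) (auto simp: AE_measure_pmf_iff intro: integrable_measure_pmf_finite)

text \<open>The value \<open>Psi m / \<epsilon>\<close> occurs with probability
  \<open>\<epsilon>\<close>, which leaves the factor \<open>Psi m\<close>. The error
  \<open>\<epsilon> * (1 + n * \<epsilon>)\<close> pays for an earlier value selected when the last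
  one is large, and \<open>n * \<epsilon>\<close> for the excess over 1 when it is zero.\<close>

lemma expectation_alg_value_le:
  assumes "0 < \<epsilon>" "\<epsilon> \<le> 1" "0 \<le> \<tau>" "Psi m / \<epsilon> > 1 + n * \<epsilon>"
  shows "measure_pmf.expectation (instance_pmf m n \<epsilon>) (alg_value m n \<tau>)
    \<le> Psi m * measure_pmf.prob (initial_pmf m n \<epsilon>) {X. exceedances n \<tau> X \<le> m}
      + measure_pmf.prob (initial_pmf m n \<epsilon>) {X. exceedances n \<tau> X \<ge> 1}
      + \<epsilon> * (1 + n * \<epsilon>) + n * \<epsilon>"
proof -
  let ?M = "initial_pmf m n \<epsilon>"
  let ?E = "measure_pmf.expectation ?M"
  let ?p = "measure_pmf.prob ?M {X. exceedances n \<tau> X \<ge> 1}"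
  let ?q = "measure_pmf.prob ?M {X. exceedances n \<tau> X \<le> m}"
  note [simp] = integrable_measure_pmf_finite[OF finite_set_initial_pmf]
  have "?E (\<lambda>X. alg_value m n \<tau> (X(n + 2 := Psi m / \<epsilon>)))
      \<le> ?E (\<lambda>X. Psi m / \<epsilon> * of_bool (exceedances n \<tau> X \<le> m) + (1 + n * \<epsilon>))"
    by (intro expectation_mono_pmf finite_set_initial_pmf alg_value_last_large_le[OF _ assms(1,3,4)])
  also have "\<dots> = Psi m / \<epsilon> * ?q + (1 + n * \<epsilon>)"
    by (simp add: expectation_of_bool)
  finally have "\<epsilon> * ?E (\<lambda>X. alg_value m n \<tau> (X(n + 2 := Psi m / \<epsilon>)))
      \<le> \<epsilon> * (Psi m / \<epsilon> * ?q + (1 + n * \<epsilon>))"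
    using assms by (intro mult_left_mono) auto
  moreover have "\<dots> = Psi m * ?q + \<epsilon> * (1 + n * \<epsilon>)" using assms by (simp add: field_simps)
  moreover have "(1 - \<epsilon>) * ?E (\<lambda>X. alg_value m n \<tau> (X(n + 2 := 0))) \<le> ?p + n * \<epsilon>"
  proof -
    have "?E (\<lambda>X. alg_value m n \<tau> (X(n + 2 := 0)))
        \<le> ?E (\<lambda>X. (1 + n * \<epsilon>) * of_bool (exceedances n \<tau> X \<ge> 1))"
      by (intro expectation_mono_pmf finite_set_initial_pmf alg_value_last_zero_le[OF _ assms(1,3)])
    also have "\<dots> = (1 + n * \<epsilon>) * ?p" by (simp add: expectation_of_bool)
    finally have "(1 - \<epsilon>) * ?E (\<lambda>X. alg_value m n \<tau> (X(n + 2 := 0))) \<le> (1 - \<epsilon>) * ((1 + n * \<epsilon>) * ?p)"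
      using assms by (intro mult_left_mono) auto
    also have "\<dots> \<le> 1 * ((1 + n * \<epsilon>) * ?p)" using assms by (intro mult_right_mono) auto
    also have "\<dots> = ?p + n * \<epsilon> * ?p" by (simp add: algebra_simps)
    also have "n * \<epsilon> * ?p \<le> n * \<epsilon> * 1" using assms by (intro mult_left_mono) auto
    finally show ?thesis by simp
  qed
  ultimately show ?thesis
    unfolding expectation_instance_pmf[OF less_imp_le[OF assms(1)] assms(2)] by linarith
qed

text \<open>A large last value has probability \<open>\<epsilon>\<close> and is counted as a sure
  win.\<close>

lemma prob_alg_value_eq_max_le:
  assumes "0 < \<epsilon>" "\<epsilon> \<le> 1" "0 \<le> \<tau>"
  shows "measure_pmf.prob (instance_pmf m n \<epsilon>) {X. alg_value m n \<tau> X = max_value n X}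
    \<le> measure_pmf.prob (initial_pmf m n \<epsilon>) {X. exceedances n \<tau> X \<in> {1..Suc m}} + \<epsilon>"
proof -
  let ?M = "initial_pmf m n \<epsilon>"
  let ?W = "\<lambda>y. {X. alg_value m n \<tau> (X(n + 2 := y)) = max_value n (X(n + 2 := y))}"
  have "measure_pmf.prob (instance_pmf m n \<epsilon>) {X. alg_value m n \<tau> X = max_value n X}
      = \<epsilon> * measure_pmf.prob ?M (?W (Psi m / \<epsilon>)) + (1 - \<epsilon>) * measure_pmf.prob ?M (?W 0)"
    unfolding expectation_of_bool[symmetric]
    by (rule expectation_instance_pmf[OF less_imp_le[OF assms(1)] assms(2)])
  also have "\<dots> \<le> \<epsilon> * 1 + 1 * measure_pmf.prob ?M (?W 0)"
    using assms by (intro add_mono mult_mono) auto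
  also have "measure_pmf.prob ?M (?W 0) \<le> measure_pmf.prob ?M {X. exceedances n \<tau> X \<in> {1..Suc m}}"
    by (rule measure_pmf.finite_measure_mono_AE)
      (use alg_value_eq_max_imp assms in \<open>auto simp: AE_measure_pmf_iff\<close>)
  finally show ?thesis by simp
qed

text \<open>A large last value contributes \<open>Psi m\<close>; otherwise the constant first value
  keeps the maximum at 1 or more.\<close>

lemma expectation_max_value_ge:
  assumes "0 < \<epsilon>" "\<epsilon> \<le> 1"
  shows "measure_pmf.expectation (instance_pmf m n \<epsilon>) (max_value n) \<ge> Psi m + 1 - \<epsilon>"
proof -
  let ?E = "measure_pmf.expectation (initial_pmf m n \<epsilon>)"
  have le_max: "X i \<le> max_value n X" if "i \<in> {1..n + 2}" for i X
    unfolding max_value_def using that by (intro Max_ge) auto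
  have "?E (\<lambda>X. Psi m / \<epsilon>) \<le> ?E (\<lambda>X. max_value n (X(n + 2 := Psi m / \<epsilon>)))"
    using le_max[of "n + 2" "X(n + 2 := Psi m / \<epsilon>)" for X]
    by (intro expectation_mono_pmf finite_set_initial_pmf) simp
  moreover have "?E (\<lambda>X. 1) \<le> ?E (\<lambda>X. max_value n (X(n + 2 := 0)))"
  proof (intro expectation_mono_pmf finite_set_initial_pmf)
    show "1 \<le> max_value n (X(n + 2 := 0))" if "X \<in> set_pmf (initial_pmf m n \<epsilon>)" for X
      using le_max[of 1 "X(n + 2 := 0)"] set_initial_pmfD(1)[OF that] by simp
  qed
  ultimately have "\<epsilon> * (Psi m / \<epsilon>) + (1 - \<epsilon>) * 1
      \<le> \<epsilon> * ?E (\<lambda>X. max_value n (X(n + 2 := Psi m / \<epsilon>))) + (1 - \<epsilon>) * ?E (\<lambda>X. max_value n (X(n + 2 := 0)))"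
    using assms by (intro add_mono mult_left_mono) auto
  then show ?thesis using assms by (subst expectation_instance_pmf) auto
qed

section \<open>The exceedance count as a binomial variable\<close>

lemma prob_binomial_atMost:
  fixes p :: real
  assumes "0 \<le> p" "p \<le> 1"
  shows "measure_pmf.prob (binomial_pmf n p) {..m} = (\<Sum>k\<le>m. (n choose k) * p ^ k * (1 - p) ^ (n - k))"
  using assms by (simp add: measure_measure_pmf_finite)

lemma prob_binomial_atLeast_1:
  assumes "0 \<le> p" "p \<le> 1"
  shows "measure_pmf.prob (binomial_pmf n p) {1..} = 1 - (1 - p) ^ n"
proof -
  have "{1..} = UNIV - {0::nat}" by auto
  then show ?thesis
    using assms measure_pmf.prob_compl[of "{0}" "binomial_pmf n p"] by (simp add: measure_pmf_single)
qed

text \<open>\<open>N\<close> is chosen before \<open>A\<close> because the reward combines two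
  events, which need the same \<open>N\<close>. For \<open>\<tau> < 1\<close> the preimage under
  \<open>Suc\<close> discounts the constant first value.\<close>

lemma prob_exceedances:
  fixes n :: nat
  assumes "0 \<le> \<epsilon>" "0 \<le> \<tau>" "0 \<le> xi m / n" "xi m / n \<le> 1"
  shows "\<tau> \<ge> 1 \<Longrightarrow> \<exists>N\<le>n. \<forall>A. measure_pmf.prob (initial_pmf m n \<epsilon>) {X. exceedances n \<tau> X \<in> A}
           = measure_pmf.prob (binomial_pmf N (xi m / n)) A"
    and "\<tau> < 1 \<Longrightarrow> measure_pmf.prob (initial_pmf m n \<epsilon>) {X. exceedances n \<tau> X \<in> A}
           = measure_pmf.prob (binomial_pmf n (xi m / n)) (Suc -` A)"
proof -
  let ?M = "initial_pmf m n \<epsilon>"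
  have prob: "measure_pmf.prob ?M {X. exceedances n \<tau> X \<in> A}
      = measure_pmf.prob (binomial_pmf (card J) (xi m / n)) (g -` A)"
    if "J \<subseteq> {2..n + 1}" "\<And>X. X \<in> set_pmf ?M \<Longrightarrow> exceedances n \<tau> X = g (card {i \<in> J. X i \<noteq> 0})" for A J g
    unfolding map_pmf_card_nonzero_initial_pmf[OF that(1) assms(1,3,4), symmetric] measure_map_pmf
    by (rule measure_pmf.finite_measure_eq_AE) (auto simp: AE_measure_pmf_iff that(2))
  show "\<exists>N\<le>n. \<forall>A. measure_pmf.prob ?M {X. exceedances n \<tau> X \<in> A}
           = measure_pmf.prob (binomial_pmf N (xi m / n)) A" if "\<tau> \<ge> 1"
  proof (intro exI conjI allI)
    let ?J = "{i \<in> {2..n + 1}. 1 + \<epsilon> * (real i - 1) > \<tau>}"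
    show "card ?J \<le> n" by (rule order_trans[OF card_mono[of "{2..n + 1}"]]) auto
    have J: "?J \<subseteq> {2..n + 1}" by auto
    show "measure_pmf.prob ?M {X. exceedances n \<tau> X \<in> A}
        = measure_pmf.prob (binomial_pmf (card ?J) (xi m / n)) A" for A
      using prob[where g = "\<lambda>c. c" and A = A, OF J exceedances_eq(1)[OF _ assms(1,2) that]]
      by (simp only: vimage_ident)
  qed
  show "measure_pmf.prob ?M {X. exceedances n \<tau> X \<in> A}
      = measure_pmf.prob (binomial_pmf n (xi m / n)) (Suc -` A)" if "\<tau> < 1"
    using prob[where g = Suc, OF order_refl exceedances_eq(2)[OF _ assms(1,2) that]]
    by (simp only: card_atLeastAtMost) simp
qed

text \<open>
  Passing from \<open>N\<close> to \<open>N + 1\<close> changes the left-hand side by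
  \<open>p (1 - p)\<^sup>N\<^sup>-\<^sup>m ((1 - p)\<^sup>m - m! (N choose m) p\<^sup>m / x\<^sup>m)\<close>, where the subtracted term is at most 1, so it drops by at
  most \<open>m p\<^sup>2\<close> per step.
\<close>
lemma binomial_reward_le:
  fixes x p :: real and n :: nat
  defines "p \<equiv> x / n"
  assumes "0 < x" "x \<le> n" "N \<le> n"
  shows "fact m / x ^ m * (\<Sum>k\<le>m. (N choose k) * p ^ k * (1 - p) ^ (N - k)) + (1 - (1 - p) ^ N)
    \<le> fact m / x ^ m * (\<Sum>k\<le>m. (n choose k) * p ^ k * (1 - p) ^ (n - k)) + (1 - (1 - p) ^ n)
      + m * x\<^sup>2 / n"
proof -
  define g where "g N = fact m / x ^ m * (\<Sum>k\<le>m. (N choose k) * p ^ k * (1 - p) ^ (N - k)) + (1 - (1 - p) ^ N)"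
    for N :: nat
  have "n > 0" using assms by (cases n) auto
  have p: "0 < p" "p \<le> 1" using assms \<open>n > 0\<close> by (auto simp: p_def field_simps)
  have step: "g N \<le> g (Suc N) + m * p\<^sup>2" if "N < n" for N
  proof -
    have diff: "g (Suc N) - g N = p * ((1 - p) ^ N - fact m / x ^ m * (N choose m) * p ^ m * (1 - p) ^ (N - m))"
      unfolding g_def binomial_mass_Suc by (simp add: algebra_simps)
    have "(1 - p) ^ N - fact m / x ^ m * (N choose m) * p ^ m * (1 - p) ^ (N - m) \<ge> - (m * p)"
    proof (cases "m \<le> N")
      case True
      \<comment> \<open>Dividing by \<open>x ^ m\<close> turns \<open>p ^ m\<close> into
        \<open>1 / n ^ m\<close>, so this bound and \<open>N < n\<close> make the coefficient at
        most 1.\<close>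
      have "fact m * (N choose m) \<le> N ^ m"
        using binomial_fact_pow[of N m] by (simp add: mult.commute)
      then have "fact m * real (N choose m) \<le> real N ^ m"
        by (metis of_nat_fact of_nat_le_iff of_nat_mult of_nat_power)
      also have "\<dots> \<le> real n ^ m" using that by (intro power_mono) auto
      finally have "fact m / x ^ m * (N choose m) * p ^ m \<le> 1"
        using \<open>0 < x\<close> \<open>n > 0\<close> by (simp add: p_def power_divide field_simps)
      moreover have "1 - m * p \<le> (1 - p) ^ m"
        using Bernoulli_inequality[of "- p" m] p by simp
      ultimately have "(1 - p) ^ (N - m) * ((1 - p) ^ m - fact m / x ^ m * (N choose m) * p ^ m)
          \<ge> (1 - p) ^ (N - m) * (- (m * p))"
        using p by (intro mult_left_mono) auto
      moreover have "(1 - p) ^ (N - m) * (m * p) \<le> 1 * (m * p)"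
        using p by (intro mult_right_mono power_le_one) auto
      moreover have "(1 - p) ^ N = (1 - p) ^ (N - m) * (1 - p) ^ m"
        using True by (simp flip: power_add)
      ultimately show ?thesis by (simp add: algebra_simps)
    next
      case False
      then have "fact m / x ^ m * (N choose m) * p ^ m * (1 - p) ^ (N - m) = 0"
        by (simp add: binomial_eq_0)
      moreover have "0 \<le> m * p" "0 \<le> (1 - p) ^ N" using p by auto
      ultimately show ?thesis by linarith
    qed
    then have "p * ((1 - p) ^ N - fact m / x ^ m * (N choose m) * p ^ m * (1 - p) ^ (N - m)) \<ge> p * - (m * p)"
      using p by (intro mult_left_mono) auto
    with diff show ?thesis by (simp add: power2_eq_square algebra_simps)
  qed
  \<comment> \<open>At most \<open>n\<close> steps, each losing at most
    \<open>m * p\<^sup>2\<close>.\<close>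
  have "g N \<le> g n + (n - N) * (m * p\<^sup>2)"
    using \<open>N \<le> n\<close>
  proof (induction N rule: inc_induct)
    case (step N)
    then show ?case using \<open>\<And>N. N < n \<Longrightarrow> g N \<le> g (Suc N) + m * p\<^sup>2\<close>[of N]
      by (simp add: algebra_simps of_nat_diff)
  qed simp
  also have "(n - N) * (m * p\<^sup>2) \<le> n * (m * p\<^sup>2)" by (intro mult_right_mono) auto
  also have "n * (m * p\<^sup>2) = m * x\<^sup>2 / n" using \<open>n > 0\<close> by (simp add: p_def power2_eq_square)
  finally show ?thesis by (simp add: g_def)
qed

theorem theoremB4:
  fixes m :: nat and \<delta> :: real
  assumes "m \<ge> 1" and "\<delta> > 0"
  shows "\<forall>\<^sub>F n in sequentially. \<forall>\<^sub>F \<epsilon> in at_right 0. \<forall>\<tau>\<ge>0.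
           measure_pmf.expectation (instance_pmf m n \<epsilon>) (alg_value m n \<tau>)
             \<le> (1 - exp (- xi m) + \<delta>) * measure_pmf.expectation (instance_pmf m n \<epsilon>) (max_value n) \<and>
           measure_pmf.prob (instance_pmf m n \<epsilon>) {X. alg_value m n \<tau> X = max_value n X}
             \<le> 1 - exp (- xi m) + \<delta>"
proof -
  define c where "c = 1 - exp (- xi m)"
  define q where "q n N k = (N choose k) * (xi m / n) ^ k * (1 - xi m / n) ^ (N - k)"
    for n N k :: nat
  \<comment> \<open>In the limit of small \<open>\<epsilon>\<close>, \<open>G\<close> and
    \<open>W\<close> bound the reward and the winning probability for \<open>\<tau> \<ge> 1\<close>,
    \<open>H\<close> and \<open>F\<close> those for \<open>\<tau> < 1\<close>. The sum in
    \<open>H\<close> stops at \<open>m - 1\<close> because the first value is itself an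
    exceedance.\<close>
  define F where "F n = (\<Sum>k\<le>m. q n n k)" for n
  define W where "W n = 1 - (1 - xi m / real n) ^ n" for n :: nat
  define G where "G n = Psi m * F n + W n + m * (xi m)\<^sup>2 / n" for n :: nat
  define H where "H n = Psi m * (\<Sum>k\<le>m - 1. q n n k) + 1" for n
  note xi_pos = xi_pos[OF assms(1)] and poisson = poisson_cdf_xi[OF assms(1)]
  have Psi_pos: "Psi m > 0" using xi_pos by (simp add: Psi_def)
  have c_pos: "c > 0" using xi_pos by (simp add: c_def)

  have lim_q: "(\<lambda>n. q n n k) \<longlonglongrightarrow> xi m ^ k / fact k * exp (- xi m)" for k
    unfolding q_def by (rule tendsto_binomial_poisson)
  have lim_F: "F \<longlonglongrightarrow> c"
    unfolding F_def c_def poisson[symmetric] by (intro tendsto_sum lim_q)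
  have lim_W: "W \<longlonglongrightarrow> c"
    unfolding W_def c_def using tendsto_exp_limit_sequentially[of "- xi m"]
    by (intro tendsto_diff tendsto_const) simp
  have "G \<longlonglongrightarrow> Psi m * c + c + 0"
    unfolding G_def by (intro tendsto_add tendsto_mult tendsto_const lim_F lim_W) real_asymp
  then have lim_G: "G \<longlonglongrightarrow> c * (Psi m + 1)" by (simp add: algebra_simps)
  have "H \<longlonglongrightarrow> Psi m * (\<Sum>k\<le>m - 1. xi m ^ k / fact k * exp (- xi m)) + 1"
    unfolding H_def by (intro tendsto_add tendsto_mult tendsto_const tendsto_sum lim_q)
  also have "(\<Sum>k\<le>m - 1. xi m ^ k / fact k * exp (- xi m)) = c - xi m ^ m / fact m * exp (- xi m)"
    using poisson assms(1) by (cases m) (auto simp: c_def)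
  \<comment> \<open>By the choice of \<open>Psi\<close>, \<open>Psi m\<close> times the Poisson mass
    at \<open>m\<close> is \<open>exp (- xi m)\<close>; this makes the limits of \<open>G\<close>
    and \<open>H\<close> agree.\<close>
  also have "Psi m * (c - xi m ^ m / fact m * exp (- xi m)) + 1 = c * (Psi m + 1)"
    using xi_pos by (simp add: Psi_def c_def field_simps)
  finally have lim_H: "H \<longlonglongrightarrow> c * (Psi m + 1)" .

  have "c * (Psi m + 1) < (c + \<delta>) * (Psi m + 1)" using assms(2) Psi_pos by simp
  then have "\<forall>\<^sub>F n in sequentially. G n < (c + \<delta>) * (Psi m + 1)"
      "\<forall>\<^sub>F n in sequentially. H n < (c + \<delta>) * (Psi m + 1)"
    using lim_G lim_H by (auto dest: order_tendstoD(2))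
  moreover have "\<forall>\<^sub>F n in sequentially. F n < c + \<delta>" "\<forall>\<^sub>F n in sequentially. W n < c + \<delta>"
    using order_tendstoD(2)[OF lim_F, of "c + \<delta>"] order_tendstoD(2)[OF lim_W, of "c + \<delta>"] assms(2)
    by simp_all
  moreover have "\<forall>\<^sub>F n in sequentially. n > nat \<lceil>xi m\<rceil>" by (rule eventually_gt_at_top)
  ultimately have "\<forall>\<^sub>F n in sequentially. \<forall>\<^sub>F \<epsilon> in at_right 0. \<forall>\<tau>\<ge>0.
           measure_pmf.expectation (instance_pmf m n \<epsilon>) (alg_value m n \<tau>)
             \<le> (c + \<delta>) * measure_pmf.expectation (instance_pmf m n \<epsilon>) (max_value n) \<and>
           measure_pmf.prob (instance_pmf m n \<epsilon>) {X. alg_value m n \<tau> X = max_value n X}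
             \<le> c + \<delta>"
  proof eventually_elim
    case (elim n)
    then have n: "xi m < n" by linarith
    then have p: "0 \<le> xi m / n" "xi m / n \<le> 1" using xi_pos by auto
    \<comment> \<open>Each inequality below is strict at \<open>\<epsilon> = 0\<close> and
      continuous there.\<close>
    have small: "\<forall>\<^sub>F \<epsilon> in at_right 0. f \<epsilon> < b" if "(f \<longlongrightarrow> f 0) (at_right 0)" "f 0 < b"
      for f :: "real \<Rightarrow> real" and b
      using that by (rule order_tendstoD)
    \<comment> \<open>The summand \<open>(c + \<delta>) * \<epsilon>\<close> offsets the
      \<open>- \<epsilon>\<close> in the lower bound for the expected maximum.\<close>
    have "\<forall>\<^sub>F \<epsilon> in at_right (0::real). G n + \<epsilon> * (1 + n * \<epsilon>) + n * \<epsilon> + (c + \<delta>) * \<epsilon> < (c + \<delta>) * (Psi m + 1)"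
        "\<forall>\<^sub>F \<epsilon> in at_right (0::real). H n + \<epsilon> * (1 + n * \<epsilon>) + n * \<epsilon> + (c + \<delta>) * \<epsilon> < (c + \<delta>) * (Psi m + 1)"
        "\<forall>\<^sub>F \<epsilon> in at_right (0::real). F n + \<epsilon> < c + \<delta>" "\<forall>\<^sub>F \<epsilon> in at_right (0::real). W n + \<epsilon> < c + \<delta>"
        "\<forall>\<^sub>F \<epsilon> in at_right (0::real). \<epsilon> * (1 + n * \<epsilon>) < Psi m" "\<forall>\<^sub>F \<epsilon> in at_right (0::real). \<epsilon> < 1"
      by (rule small; use elim Psi_pos in \<open>auto intro!: tendsto_eq_intros\<close>)+
    then show ?case using eventually_at_right_less[of "0::real"]
    proof eventually_elim
      case \<epsilon>: (elim \<epsilon>)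
      have large: "Psi m / \<epsilon> > 1 + n * \<epsilon>" using \<epsilon> by (simp add: field_simps)
      have max: "(c + \<delta>) * (Psi m + 1 - \<epsilon>)
          \<le> (c + \<delta>) * measure_pmf.expectation (instance_pmf m n \<epsilon>) (max_value n)"
        using expectation_max_value_ge[of \<epsilon> m n] \<epsilon> c_pos assms(2) by (intro mult_left_mono) auto
      \<comment> \<open>These bounds are free of \<open>\<tau>\<close>, so one
        \<open>\<epsilon>\<close> serves all thresholds.\<close>
      have *: "measure_pmf.expectation (instance_pmf m n \<epsilon>) (alg_value m n \<tau>)
             \<le> max (G n) (H n) + \<epsilon> * (1 + n * \<epsilon>) + n * \<epsilon> \<and>
           measure_pmf.prob (instance_pmf m n \<epsilon>) {X. alg_value m n \<tau> X = max_value n X}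
             \<le> max (F n) (W n) + \<epsilon>" if "\<tau> \<ge> 0" for \<tau>
      proof -
        let ?P = "\<lambda>A. measure_pmf.prob (initial_pmf m n \<epsilon>) {X. exceedances n \<tau> X \<in> A}"
        have "Psi m * ?P {..m} + ?P {1..} \<le> max (G n) (H n) \<and> ?P {1..Suc m} \<le> max (F n) (W n)"
        proof (cases "\<tau> \<ge> 1")
          case True
          then obtain N where N: "N \<le> n" "\<And>A. ?P A = measure_pmf.prob (binomial_pmf N (xi m / n)) A"
            using prob_exceedances(1)[of \<epsilon> \<tau> m n] p \<epsilon> that by force
          have "Psi m * ?P {..m} + ?P {1..} \<le> G n"
            unfolding N(2) prob_binomial_atMost[OF p] prob_binomial_atLeast_1[OF p]
              G_def F_def W_def q_def Psi_def
            using binomial_reward_le[of "xi m" n N m] N(1) n xi_pos by simp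
          moreover have "?P {1..Suc m} \<le> ?P {1..}"
            by (intro measure_pmf.finite_measure_mono) auto
          moreover have "?P {1..} \<le> W n"
            unfolding N(2) prob_binomial_atLeast_1[OF p] W_def
            using N(1) p by (simp add: power_decreasing)
          ultimately show ?thesis by linarith
        next
          case False
          then have P: "?P A = measure_pmf.prob (binomial_pmf n (xi m / n)) (Suc -` A)" for A
            using prob_exceedances(2)[of \<epsilon> \<tau> m n A] p \<epsilon> that by simp
          \<comment> \<open>The first equation needs \<open>m \<ge> 1\<close>: for
            \<open>m = 0\<close> its left side is empty, while truncated subtraction leaves 0 in the
            right side.\<close>
          have vimage: "Suc -` {..m} = {..m - 1}" "Suc -` {1..Suc m} = {..m}"
            using assms(1) by auto
          have "?P {..m} = (\<Sum>k\<le>m - 1. q n n k)"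
            unfolding P vimage prob_binomial_atMost[OF p] q_def by simp
          then have "Psi m * ?P {..m} + ?P {1..} \<le> H n"
            unfolding H_def by (simp only:) (intro add_left_mono measure_pmf.prob_le_1)
          moreover have "?P {1..Suc m} = F n"
            unfolding P vimage prob_binomial_atMost[OF p] F_def q_def by simp
          ultimately show ?thesis by linarith
        qed
        then show ?thesis
          using expectation_alg_value_le[of \<epsilon> \<tau> n m] prob_alg_value_eq_max_le[of \<epsilon> \<tau> m n] \<epsilon> that large
          by (simp add: atLeast_def atMost_def)
      qed
      show ?case
      proof (intro allI impI conjI)
        fix \<tau> :: real assume "\<tau> \<ge> 0"
        note bounds = *[OF this]
        have "max (G n) (H n) + \<epsilon> * (1 + n * \<epsilon>) + n * \<epsilon> \<le> (c + \<delta>) * (Psi m + 1 - \<epsilon>)"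
          using \<epsilon> by (simp add: right_diff_distrib max_def)
        then show "measure_pmf.expectation (instance_pmf m n \<epsilon>) (alg_value m n \<tau>)
             \<le> (c + \<delta>) * measure_pmf.expectation (instance_pmf m n \<epsilon>) (max_value n)"
          using bounds max by linarith
        show "measure_pmf.prob (instance_pmf m n \<epsilon>) {X. alg_value m n \<tau> X = max_value n X} \<le> c + \<delta>"
          using bounds \<epsilon> by linarith
      qed
    qed
  qed
  then show ?thesis by (simp add: c_def)
qed

end
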